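(* For any permutation $w\in S_n$, every monomial appearing (with nonzero coefficient) in the Grothendieck polynomial $\mathfrak{G}_w$ divides $\bm{x}^{\overline{D(w)}}$.
   Context: Notation: $s_j$ is the adjacent transposition; permutations act on the right on positions, so $ws_j$ is $w$ with $w(j),w(j+1)$ swapped. $\partial_j(f)=\frac{f-s_jf}{x_j-x_{j+1}}$ ($s_jf$ swaps $x_j,x_{j+1}$), $\overline{\partial}_j(f)=\partial_j((1-x_{j+1})f)$. Grothendieck polynomials: $\mathfrak{G}_{w_0}=x_1^{n-1}x_2^{n-2}\cdots x_{n-1}$ for $w_0=n\,(n-1)\cdots1$, and $\mathfrak{G}_w=\overline{\partial}_j\mathfrak{G}_{ws_j}$ whenever $w(j)<w(j+1)$. Rothe diagram: $D(w)=\{(i,j)\in[n]^2: i<w^{-1}(j),\ j<w(i)\}$ (row $i$, column $j$). For a diagram $D\subseteq[n]^2$, its upper closure is $\overline{D}=\{(i,j): i\le i' \text{ for some }(i',j)\in D\}$, and $\bm{x}^D=\prod_{(i,j)\in D}x_i$. *)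

theory Defs
  imports
    "HOL-Library.Poly_Mapping"
    "HOL-Combinatorics.Permutations"
begin

section \<open>Integer polynomials in the variables \<open>x\<^sub>0, x\<^sub>1, x\<^sub>2, \<dots>\<close>\<close>

text \<open>A monomial is its finitely supported exponent vector, and a polynomial is a finitely
  supported map from monomials to coefficients; its product is the convolution product of
  \<open>Poly_Mapping\<close>. The set of monomials occurring in \<open>f\<close> is \<open>Poly_Mapping.keys f\<close>.
  The variable \<open>x\<^sub>0\<close> is never used.\<close>

type_synonym monom = "nat \<Rightarrow>\<^sub>0 nat"
type_synonym ipoly = "monom \<Rightarrow>\<^sub>0 int"

definition var :: "nat \<Rightarrow> ipoly" where
  "var i = Poly_Mapping.single (Poly_Mapping.single i 1) 1"

abbreviation adj_transp :: "nat \<Rightarrow> nat \<Rightarrow> nat" where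
  "adj_transp j \<equiv> transpose j (Suc j)"

text \<open>\<open>map_key\<close> is composition with an injection, so the exponent of \<open>x\<^sub>i\<close> in
  \<open>swap_monom j m\<close> is that of \<open>x\<^bsub>s\<^sub>j(i)\<^esub>\<close> in \<open>m\<close>, and the coefficient of \<open>m\<close> in
  \<open>swap_vars j f\<close> is that of \<open>swap_monom j m\<close> in \<open>f\<close>.\<close>

definition swap_monom :: "nat \<Rightarrow> monom \<Rightarrow> monom" where
  "swap_monom j = Poly_Mapping.map_key (adj_transp j)"

definition swap_vars :: "nat \<Rightarrow> ipoly \<Rightarrow> ipoly" where
  "swap_vars j = Poly_Mapping.map_key (swap_monom j)"

text \<open>The exact quotient of \<open>f - s\<^sub>j f\<close> by \<open>x\<^sub>j - x\<^bsub>j+1\<^esub>\<close>; existence and uniqueness are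
  established in \<open>div_diff_eq\<close> and \<open>div_diff_unique\<close> below.\<close>

definition div_diff :: "nat \<Rightarrow> ipoly \<Rightarrow> ipoly" where
  "div_diff j f = (THE g. g * (var j - var (Suc j)) = f - swap_vars j f)"

definition iso_div_diff :: "nat \<Rightarrow> ipoly \<Rightarrow> ipoly" where
  "iso_div_diff j f = div_diff j ((1 - var (Suc j)) * f)"


section \<open>Grothendieck polynomials\<close>

definition longest_perm :: "nat \<Rightarrow> nat \<Rightarrow> nat" where
  "longest_perm n = (\<lambda>i. if i \<in> {1..n} then Suc n - i else i)"

text \<open>\<open>grothendieck_rel n w f\<close>: the polynomial \<open>f\<close> arises for \<open>w\<close> from the defining recursion
  along some chain of ascents. That \<open>f\<close> exists and does not depend on the chain is
  \<open>grothendieck_rel_ex1\<close> below, so that \<open>grothendieck n w\<close> satisfies the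
  defining equations \<open>grothendieck_longest_perm\<close> and \<open>grothendieck_ascent\<close>.\<close>

inductive grothendieck_rel :: "nat \<Rightarrow> (nat \<Rightarrow> nat) \<Rightarrow> ipoly \<Rightarrow> bool" for n where
  longest: "grothendieck_rel n (longest_perm n) (\<Prod>i\<in>{1..n}. var i ^ (n - i))"
| ascent: "w permutes {1..n} \<Longrightarrow> 1 \<le> j \<Longrightarrow> j < n \<Longrightarrow> w j < w (Suc j) \<Longrightarrow>
    grothendieck_rel n (w \<circ> adj_transp j) f \<Longrightarrow> grothendieck_rel n w (iso_div_diff j f)"

definition grothendieck :: "nat \<Rightarrow> (nat \<Rightarrow> nat) \<Rightarrow> ipoly" where
  "grothendieck n w = (THE f. grothendieck_rel n w f)"


section \<open>Diagrams\<close>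

definition rothe_diagram :: "nat \<Rightarrow> (nat \<Rightarrow> nat) \<Rightarrow> (nat \<times> nat) set" where
  "rothe_diagram n w = {(i, j) \<in> {1..n} \<times> {1..n}. i < inv w j \<and> j < w i}"

text \<open>Rows are numbered from 1.\<close>

definition upper_closure :: "(nat \<times> nat) set \<Rightarrow> (nat \<times> nat) set" where
  "upper_closure D = {(i, j). 1 \<le> i \<and> (\<exists>i'. (i', j) \<in> D \<and> i \<le> i')}"

definition diagram_monomial :: "(nat \<times> nat) set \<Rightarrow> ipoly" where
  "diagram_monomial D = (\<Prod>(i, j)\<in>D. var i)"


section \<open>Well-definedness\<close>

lemma lookup_swap_monom: "Poly_Mapping.lookup (swap_monom j m) i = Poly_Mapping.lookup m (adj_transp j i)"
  by (simp add: swap_monom_def map_key.rep_eq)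

lemma swap_monom_swap_monom [simp]: "swap_monom j (swap_monom j m) = m"
  by (rule poly_mapping_eqI) (simp add: lookup_swap_monom)

lemma swap_monom_add: "swap_monom j (m + m') = swap_monom j m + swap_monom j m'"
  by (rule poly_mapping_eqI) (simp add: lookup_swap_monom lookup_add)

lemma swap_monom_0 [simp]: "swap_monom j 0 = 0"
  by (rule poly_mapping_eqI) (simp add: lookup_swap_monom)

lemma swap_monom_single:
  "swap_monom j (Poly_Mapping.single i a) = Poly_Mapping.single (adj_transp j i) a"
  by (rule poly_mapping_eqI)
     (auto simp: lookup_swap_monom lookup_single when_def transpose_eq_iff)

lemma inj_swap_monom: "inj (swap_monom j)"
  by (metis injI swap_monom_swap_monom)

lemma lookup_swap_vars: "Poly_Mapping.lookup (swap_vars j f) m = Poly_Mapping.lookup f (swap_monom j m)"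
  by (simp add: swap_vars_def map_key.rep_eq inj_swap_monom)

lemma swap_vars_swap_vars [simp]: "swap_vars j (swap_vars j f) = f"
  by (rule poly_mapping_eqI) (simp add: lookup_swap_vars)

lemma swap_vars_add: "swap_vars j (f + g) = swap_vars j f + swap_vars j g"
  by (rule poly_mapping_eqI) (simp add: lookup_swap_vars lookup_add)

lemma swap_vars_diff: "swap_vars j (f - g) = swap_vars j f - swap_vars j g"
  by (rule poly_mapping_eqI) (simp add: lookup_swap_vars lookup_minus)

lemma swap_vars_0 [simp]: "swap_vars j 0 = 0"
  by (rule poly_mapping_eqI) (simp add: lookup_swap_vars)

lemma swap_vars_single:
  "swap_vars j (Poly_Mapping.single m c) = Poly_Mapping.single (swap_monom j m) c"
  by (rule poly_mapping_eqI) (auto simp: lookup_swap_vars lookup_single when_def)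

lemma swap_vars_1 [simp]: "swap_vars j 1 = 1"
  by (metis single_one swap_monom_0 swap_vars_single)

lemma swap_vars_mult: "swap_vars j (f * g) = swap_vars j f * swap_vars j g"
proof -
  have single: "swap_vars j (frag_of m * g) = swap_vars j (frag_of m) * swap_vars j g" for m
    using subset_UNIV
  proof (induction g rule: frag_induction)
    case (one m')
    show ?case
      by (simp add: mult_single swap_vars_single swap_monom_add)
  qed (simp_all add: swap_vars_diff right_diff_distrib)
  show ?thesis
    using subset_UNIV
    by (induction f rule: frag_induction) (simp_all add: single swap_vars_diff left_diff_distrib)
qed

lemma swap_vars_var: "swap_vars j (var i) = var (adj_transp j i)"
  by (simp add: var_def swap_vars_single swap_monom_single)

lemma swap_vars_var_simps [simp]:
  "swap_vars j (var j) = var (Suc j)"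
  "swap_vars j (var (Suc j)) = var j"
  "i \<noteq> j \<Longrightarrow> i \<noteq> Suc j \<Longrightarrow> swap_vars j (var i) = var i"
  by (simp_all add: swap_vars_var transpose_def)

lemma swap_vars_commute:
  assumes "Suc j < k"
  shows "swap_vars j (swap_vars k f) = swap_vars k (swap_vars j f)"
proof (rule poly_mapping_eqI)
  fix m
  have "swap_monom k (swap_monom j m) = swap_monom j (swap_monom k m)"
    by (rule poly_mapping_eqI) (use assms in \<open>auto simp: lookup_swap_monom transpose_def\<close>)
  then show "Poly_Mapping.lookup (swap_vars j (swap_vars k f)) m = Poly_Mapping.lookup (swap_vars k (swap_vars j f)) m"
    by (simp add: lookup_swap_vars)
qed

lemma swap_vars_braid:
  "swap_vars j (swap_vars (Suc j) (swap_vars j f)) =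
   swap_vars (Suc j) (swap_vars j (swap_vars (Suc j) f))"
proof (rule poly_mapping_eqI)
  fix m
  have "swap_monom j (swap_monom (Suc j) (swap_monom j m)) =
        swap_monom (Suc j) (swap_monom j (swap_monom (Suc j) m))"
    by (rule poly_mapping_eqI) (auto simp: lookup_swap_monom transpose_def)
  then show "Poly_Mapping.lookup (swap_vars j (swap_vars (Suc j) (swap_vars j f))) m =
      Poly_Mapping.lookup (swap_vars (Suc j) (swap_vars j (swap_vars (Suc j) f))) m"
    by (simp add: lookup_swap_vars)
qed

lemma var_eq_iff [simp]: "var i = var k \<longleftrightarrow> i = k"
proof
  assume "var i = var k"
  then have "Poly_Mapping.keys (var i) = Poly_Mapping.keys (var k)" by simp
  then have "Poly_Mapping.single i (1::nat) = Poly_Mapping.single k 1"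
    by (simp add: var_def)
  then have "Poly_Mapping.keys (Poly_Mapping.single i (1::nat)) = Poly_Mapping.keys (Poly_Mapping.single k (1::nat))"
    by simp
  then show "i = k" by simp
qed simp

lemma var_power: "var i ^ a = Poly_Mapping.single (Poly_Mapping.single i a) 1"
  by (induction a) (simp_all add: var_def mult_single flip: single_add)

lemma power_swap_dvd:
  fixes x y :: "'a :: comm_ring_1"
  shows "x - y dvd x ^ a * y ^ b - x ^ b * y ^ a"
proof -
  have "x ^ a * y ^ b - x ^ b * y ^ a = y ^ b * (x ^ a - y ^ a) - y ^ a * (x ^ b - y ^ b)"
    by (simp add: algebra_simps)
  moreover have "x - y dvd x ^ k - y ^ k" for k
    by (metis dvd_triv_left power_diff_sumr2)
  ultimately show ?thesis
    by (metis dvd_diff dvd_mult)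
qed

lemma diff_swap_vars_dvd: "var j - var (Suc j) dvd f - swap_vars j f"
  using subset_UNIV
proof (induction f rule: frag_induction)
  case (one m)
  define a b where "a = Poly_Mapping.lookup m j" and "b = Poly_Mapping.lookup m (Suc j)"
  define s where "s = Poly_Mapping.single j a + Poly_Mapping.single (Suc j) b"
  define r where "r = m - s"
  have m: "m = s + r"
    by (rule poly_mapping_eqI)
       (auto simp: r_def s_def lookup_add lookup_minus a_def b_def lookup_single when_def)
  have sr: "swap_monom j r = r"
    by (rule poly_mapping_eqI)
       (auto simp: lookup_swap_monom transpose_def r_def s_def lookup_add lookup_minus
         a_def b_def lookup_single when_def)
  have "frag_of m = var j ^ a * var (Suc j) ^ b * frag_of r"
    by (simp add: m s_def var_power mult_single)
  moreover have "swap_vars j (frag_of m) = var j ^ b * var (Suc j) ^ a * frag_of r"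
    by (simp add: m s_def var_power mult_single swap_vars_single swap_monom_add sr
        swap_monom_single add.commute)
  ultimately have "frag_of m - swap_vars j (frag_of m) =
      (var j ^ a * var (Suc j) ^ b - var j ^ b * var (Suc j) ^ a) * frag_of r"
    by (simp add: left_diff_distrib)
  then show ?case
    by (simp add: power_swap_dvd)
next
  case (diff f g)
  have "f - g - swap_vars j (f - g) = (f - swap_vars j f) - (g - swap_vars j g)"
    by (simp add: swap_vars_diff)
  then show ?case
    using diff by (metis dvd_diff)
qed simp

lemma div_diff_unique:
  assumes "g * (var j - var (Suc j)) = f - swap_vars j f"
  shows "div_diff j f = g"
  unfolding div_diff_def
proof (rule the_equality)
  fix h
  assume "h * (var j - var (Suc j)) = f - swap_vars j f"
  then show "h = g"
    using assms by (metis mult_right_cancel n_not_Suc_n right_minus_eq var_eq_iff)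
qed (rule assms)

lemma div_diff_eq: "div_diff j f * (var j - var (Suc j)) = f - swap_vars j f"
  using diff_swap_vars_dvd[of j f] div_diff_unique
  by (metis dvd_def mult.commute)

lemma iso_div_diff_eq:
  "iso_div_diff j f * (var j - var (Suc j)) =
   (1 - var (Suc j)) * f - (1 - var j) * swap_vars j f"
  by (simp add: iso_div_diff_def div_diff_eq swap_vars_mult swap_vars_diff)

lemma iso_div_diff_swap:
  "swap_vars k (iso_div_diff j f) * (swap_vars k (var j) - swap_vars k (var (Suc j))) =
   (1 - swap_vars k (var (Suc j))) * swap_vars k f -
   (1 - swap_vars k (var j)) * swap_vars k (swap_vars j f)"
  using arg_cong[OF iso_div_diff_eq[of j f], of "swap_vars k"]
  by (simp add: swap_vars_mult swap_vars_diff)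

lemma iso_div_diff_commute:
  assumes "Suc j < k"
  shows "iso_div_diff j (iso_div_diff k f) = iso_div_diff k (iso_div_diff j f)"
proof -
  define a b c d where "a = var j" and "b = var (Suc j)" and "c = var k" and "d = var (Suc k)"
  note abcd = a_def[symmetric] b_def[symmetric] c_def[symmetric] d_def[symmetric]
  have [simp]: "swap_vars j c = c" "swap_vars j d = d" "swap_vars k a = a" "swap_vars k b = b"
    using assms by (simp_all add: a_def b_def c_def d_def)
  define p q where "p = iso_div_diff k f" and "q = iso_div_diff j f"
  have p: "p * (c - d) = (1 - d) * f - (1 - c) * swap_vars k f"
    "swap_vars j p * (c - d) = (1 - d) * swap_vars j f - (1 - c) * swap_vars j (swap_vars k f)"
    using iso_div_diff_eq[of k f] iso_div_diff_swap[of j k f] by (simp_all add: abcd p_def)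
  have q: "q * (a - b) = (1 - b) * f - (1 - a) * swap_vars j f"
    "swap_vars k q * (a - b) = (1 - b) * swap_vars k f - (1 - a) * swap_vars j (swap_vars k f)"
    using iso_div_diff_eq[of j f] iso_div_diff_swap[of k j f] swap_vars_commute[OF assms, of f]
    by (simp_all add: abcd q_def)
  have "iso_div_diff j p * (a - b) * (c - d) =
      (1 - b) * (p * (c - d)) - (1 - a) * (swap_vars j p * (c - d))"
    using iso_div_diff_eq[of j p] by (simp add: abcd left_diff_distrib mult.assoc)
  also have "\<dots> = (1 - d) * (q * (a - b)) - (1 - c) * (swap_vars k q * (a - b))"
    unfolding p q by (simp add: algebra_simps)
  also have "\<dots> = (iso_div_diff k q * (c - d)) * (a - b)"
    using iso_div_diff_eq[of k q] by (simp add: abcd left_diff_distrib mult.assoc)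
  finally have "iso_div_diff j p * ((a - b) * (c - d)) = iso_div_diff k q * ((a - b) * (c - d))"
    by (simp add: ac_simps)
  moreover have "(a - b) * (c - d) \<noteq> 0"
    by (simp add: a_def b_def c_def d_def)
  ultimately show ?thesis
    by (simp add: p_def q_def)
qed

lemma iso_div_diff_braid:
  "iso_div_diff j (iso_div_diff (Suc j) (iso_div_diff j f)) =
   iso_div_diff (Suc j) (iso_div_diff j (iso_div_diff (Suc j) f))"
proof -
  define a b c where "a = var j" and "b = var (Suc j)" and "c = var (Suc (Suc j))"
  note abc = a_def[symmetric] b_def[symmetric] c_def[symmetric]
  define s t where "s = swap_vars j" and "t = swap_vars (Suc j)"
  note st = s_def[symmetric] t_def[symmetric]
  have [simp]: "s a = b" "s b = a" "s c = c" "t a = a" "t b = c" "t c = b"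
    by (simp_all add: a_def b_def c_def s_def t_def)
  have [simp]: "s (s g) = g" "t (t g) = g" for g
    by (simp_all add: s_def t_def)
  have hom: "s (g * h) = s g * s h" "t (g * h) = t g * t h"
    "s (g - h) = s g - s h" "t (g - h) = t g - t h" "s 1 = 1" "t 1 = 1" for g h
    by (simp_all add: s_def t_def swap_vars_mult swap_vars_diff)
  define P Q where "P = iso_div_diff j" and "Q = iso_div_diff (Suc j)"
  have P: "P g * (a - b) = (1 - b) * g - (1 - a) * s g" for g
    using iso_div_diff_eq[of j g] by (simp add: abc st P_def)
  have Q: "Q g * (b - c) = (1 - c) * g - (1 - b) * t g" for g
    using iso_div_diff_eq[of "Suc j" g] by (simp add: abc st Q_def)
  have sP: "s (P g) * (a - b) = P g * (a - b)" for g
  proof -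
    have "s (P g) * (b - a) = (1 - a) * s g - (1 - b) * g"
      using arg_cong[OF P[of g], of s] by (simp add: hom)
    then show ?thesis
      unfolding P by algebra
  qed
  have tQ: "t (Q g) * (b - c) = Q g * (b - c)" for g
  proof -
    have "t (Q g) * (c - b) = (1 - b) * t g - (1 - c) * g"
      using arg_cong[OF Q[of g], of t] by (simp add: hom)
    then show ?thesis
      unfolding Q by algebra
  qed
  have tP: "t (P g) * (a - c) = (1 - c) * t g - (1 - a) * t (s g)" for g
    using arg_cong[OF P[of g], of t] by (simp add: hom)
  have sQ: "s (Q g) * (a - c) = (1 - c) * s g - (1 - a) * s (t g)" for g
    using arg_cong[OF Q[of g], of s] by (simp add: hom)
  have stP: "s (t (P g)) * (b - c) = (1 - c) * s (t g) - (1 - b) * s (t (s g))" for g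
    using arg_cong[OF tP[of g], of s] by (simp add: hom)
  have tsQ: "t (s (Q g)) * (a - b) = (1 - b) * t (s g) - (1 - a) * t (s (t g))" for g
    using arg_cong[OF sQ[of g], of t] by (simp add: hom)
  have braid: "s (t (s f)) = t (s (t f))"
    by (simp add: s_def t_def swap_vars_braid)
  define E where "E = (1 - b) * (1 - c)\<^sup>2 * f - (1 - a) * (1 - c)\<^sup>2 * s f
    - (1 - c) * (1 - b)\<^sup>2 * t f + (1 - a) * (1 - b)\<^sup>2 * t (s f)
    + (1 - c) * (1 - a)\<^sup>2 * s (t f) - (1 - b) * (1 - a)\<^sup>2 * s (t (s f))"
  have ne: "a - b \<noteq> 0" "b - c \<noteq> 0" "a - c \<noteq> 0"
    by (simp_all add: a_def b_def c_def)
  have "P (Q (P f)) * (a - b) * ((a - b) * (b - c) * (a - c)) =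
      (1 - b) * (a - b) * (a - c) * (Q (P f) * (b - c))
      - (1 - a) * (a - b) * (b - c) * (s (Q (P f)) * (a - c))"
    unfolding P[of "Q (P f)"] by (simp add: algebra_simps)
  also have "\<dots> = (1 - b) * (1 - c) * (a - c) * (P f * (a - b))
      - (1 - b)\<^sup>2 * (a - b) * (t (P f) * (a - c))
      - (1 - a) * (1 - c) * (b - c) * (s (P f) * (a - b))
      + (1 - a)\<^sup>2 * (a - b) * (s (t (P f)) * (b - c))"
    unfolding Q sQ by (simp add: algebra_simps power2_eq_square)
  also have "\<dots> = (a - b) * E"
    unfolding sP unfolding P tP stP E_def by algebra
  finally have "P (Q (P f)) * ((a - b) * (b - c) * (a - c)) = E"
    using ne by (simp add: ac_simps)
  moreover have "Q (P (Q f)) * (b - c) * ((a - b) * (b - c) * (a - c)) =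
      (1 - c) * (b - c) * (a - c) * (P (Q f) * (a - b))
      - (1 - b) * (a - b) * (b - c) * (t (P (Q f)) * (a - c))"
    unfolding Q[of "P (Q f)"] by (simp add: algebra_simps)
  then have "Q (P (Q f)) * (b - c) * ((a - b) * (b - c) * (a - c)) =
      (1 - c) * (1 - b) * (a - c) * (Q f * (b - c))
      - (1 - c) * (1 - a) * (b - c) * (s (Q f) * (a - c))
      - (1 - b) * (1 - c) * (a - b) * (t (Q f) * (b - c))
      + (1 - b) * (1 - a) * (b - c) * (t (s (Q f)) * (a - b))"
    unfolding P tP by (simp add: algebra_simps)
  then have "Q (P (Q f)) * (b - c) * ((a - b) * (b - c) * (a - c)) = (b - c) * E"
    unfolding tQ unfolding Q sQ tsQ E_def braid by algebra
  then have "Q (P (Q f)) * ((a - b) * (b - c) * (a - c)) = E"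
    using ne by (simp add: ac_simps)
  ultimately have "P (Q (P f)) * ((a - b) * (b - c) * (a - c)) =
      Q (P (Q f)) * ((a - b) * (b - c) * (a - c))"
    by simp
  then show ?thesis
    using ne by (simp add: P_def Q_def)
qed

lemma longest_perm_permutes: "longest_perm n permutes {1..n}"
proof (rule bij_imp_permutes)
  show "bij_betw (longest_perm n) {1..n} {1..n}"
    by (rule bij_betwI[where g = "longest_perm n"]) (auto simp: longest_perm_def)
qed (auto simp: longest_perm_def)

lemma permutes_comp_adj_transp:
  assumes "w permutes {1..n}" "1 \<le> j" "j < n"
  shows "w \<circ> adj_transp j permutes {1..n}"
  using assms by (intro permutes_compose permutes_swap_id) auto

lemma ex_ascent:
  assumes w: "w permutes {1..n}" and ne: "w \<noteq> longest_perm n"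
  shows "\<exists>j. 1 \<le> j \<and> j < n \<and> w j < w (Suc j)"
proof (rule ccontr)
  assume no: "\<not> ?thesis"
  have range: "w i \<in> {1..n}" if "i \<in> {1..n}" for i
    using permutes_in_image[OF w] that by blast
  have step: "w (Suc j) < w j" if "1 \<le> j" "j < n" for j
  proof -
    have "w j \<noteq> w (Suc j)"
      using permutes_inj[OF w] by (simp add: inj_eq)
    moreover have "\<not> w j < w (Suc j)"
      using no that by blast
    ultimately show ?thesis by linarith
  qed
  have upper: "Suc i \<le> n \<Longrightarrow> w (Suc i) + i \<le> n" for i
  proof (induction i)
    case 0
    then show ?case using range[of 1] by simp
  next
    case (Suc i)
    then show ?case using step[of "Suc i"] by simp
  qed
  have lower: "i < n \<Longrightarrow> Suc i \<le> w (n - i)" for i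
  proof (induction i)
    case 0
    then show ?case using range[of n] by simp
  next
    case (Suc i)
    then show ?case using step[of "n - Suc i"] by (fastforce simp: Suc_diff_Suc)
  qed
  have "w i = longest_perm n i" for i
  proof (cases "i \<in> {1..n}")
    case True
    then show ?thesis
      using upper[of "i - 1"] lower[of "n - i"] by (auto simp: longest_perm_def)
  next
    case False
    then show ?thesis
      using permutes_not_in[OF w False] by (auto simp: longest_perm_def)
  qed
  then show False
    using ne by blast
qed

definition coinv :: "nat \<Rightarrow> (nat \<Rightarrow> nat) \<Rightarrow> (nat \<times> nat) set" where
  "coinv n w = {(i, k) \<in> {1..n} \<times> {1..n}. i < k \<and> w i < w k}"

lemma coinv_less:
  assumes "1 \<le> j" "j < n" "w j < w (Suc j)"
  shows "card (coinv n (w \<circ> adj_transp j)) < card (coinv n w)"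
proof -
  let ?t = "adj_transp j"
  have fin: "finite (coinv n w)"
    by (rule finite_subset[of _ "{1..n} \<times> {1..n}"]) (auto simp: coinv_def)
  have inj: "inj_on (map_prod ?t ?t) (coinv n (w \<circ> ?t))"
    by (rule inj_on_subset[OF _ subset_UNIV]) (simp add: prod.inj_map)
  have sub: "map_prod ?t ?t ` coinv n (w \<circ> ?t) \<subseteq> coinv n w - {(j, Suc j)}"
    using assms by (auto simp: coinv_def transpose_def split: if_splits)
  have "card (coinv n (w \<circ> ?t)) = card (map_prod ?t ?t ` coinv n (w \<circ> ?t))"
    by (simp add: card_image inj)
  also have "\<dots> \<le> card (coinv n w - {(j, Suc j)})"
    using fin sub by (intro card_mono) auto
  also have "\<dots> < card (coinv n w)"
    using assms fin by (intro card_Diff1_less) (auto simp: coinv_def)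
  finally show ?thesis .
qed

lemma grothendieck_rel_permutes: "grothendieck_rel n w f \<Longrightarrow> w permutes {1..n}"
  by (induction rule: grothendieck_rel.induct) (fact longest_perm_permutes)

lemma grothendieck_rel_exists:
  assumes "w permutes {1..n}"
  shows "\<exists>f. grothendieck_rel n w f"
  using assms
proof (induction "card (coinv n w)" arbitrary: w rule: less_induct)
  case less
  show ?case
  proof (cases "w = longest_perm n")
    case True
    then show ?thesis
      using grothendieck_rel.longest by blast
  next
    case False
    then obtain j where "1 \<le> j" "j < n" "w j < w (Suc j)"
      using ex_ascent less.prems by blast
    then show ?thesis
      using less coinv_less permutes_comp_adj_transp grothendieck_rel.ascent by metis
  qed
qed

lemma grothendieck_rel_unique:
  assumes "grothendieck_rel n w f" "grothendieck_rel n w f'"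
  shows "f = f'"
  using assms
proof (induction "card (coinv n w)" arbitrary: w f f' rule: less_induct)
  case less
  have w: "w permutes {1..n}"
    using less.prems(1) by (rule grothendieck_rel_permutes)
  have IH: "g = g'" if "1 \<le> j" "j < n" "w j < w (Suc j)"
    "grothendieck_rel n (w \<circ> adj_transp j) g" "grothendieck_rel n (w \<circ> adj_transp j) g'" for j g g'
    using less.hyps[OF coinv_less] that by blast
  have far: "iso_div_diff j g = iso_div_diff k g'"
    if j: "1 \<le> j" "j < n" "w j < w (Suc j)" "grothendieck_rel n (w \<circ> adj_transp j) g"
      and k: "1 \<le> k" "k < n" "w k < w (Suc k)" "grothendieck_rel n (w \<circ> adj_transp k) g'"
      and jk: "Suc j < k" for j k g g'
  proof -
    have eq: "w \<circ> adj_transp j \<circ> adj_transp k = w \<circ> adj_transp k \<circ> adj_transp j"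
      using jk by (auto simp: fun_eq_iff transpose_def)
    have pj: "w \<circ> adj_transp j permutes {1..n}" and pk: "w \<circ> adj_transp k permutes {1..n}"
      using w j k by (blast intro: permutes_comp_adj_transp le_SucI)+
    obtain u where u: "grothendieck_rel n (w \<circ> adj_transp j \<circ> adj_transp k) u"
      using grothendieck_rel_exists permutes_comp_adj_transp pj k by metis
    have "grothendieck_rel n (w \<circ> adj_transp j) (iso_div_diff k u)"
      by (rule grothendieck_rel.ascent) (use pj k jk u in \<open>simp_all add: transpose_def\<close>)
    then have "g = iso_div_diff k u"
      using IH j by blast
    moreover have "grothendieck_rel n (w \<circ> adj_transp k) (iso_div_diff j u)"
      by (rule grothendieck_rel.ascent)
         (use pk j jk u[unfolded eq] in \<open>simp_all add: transpose_def\<close>)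
    then have "g' = iso_div_diff j u"
      using IH k by blast
    ultimately show ?thesis
      using iso_div_diff_commute[OF jk] by simp
  qed
  have adjacent: "iso_div_diff j g = iso_div_diff (Suc j) g'"
    if j: "1 \<le> j" "j < n" "w j < w (Suc j)" "grothendieck_rel n (w \<circ> adj_transp j) g"
      and k: "Suc j < n" "w (Suc j) < w (Suc (Suc j))"
        "grothendieck_rel n (w \<circ> adj_transp (Suc j)) g'" for j g g'
  proof -
    let ?s = "adj_transp j" and ?t = "adj_transp (Suc j)"
    have eq: "w \<circ> ?s \<circ> ?t \<circ> ?s = w \<circ> ?t \<circ> ?s \<circ> ?t"
      by (auto simp: fun_eq_iff transpose_def)
    have ps: "w \<circ> ?s permutes {1..n}" and pt: "w \<circ> ?t permutes {1..n}"
      using w j k by (blast intro: permutes_comp_adj_transp le_SucI)+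
    have pst: "w \<circ> ?s \<circ> ?t permutes {1..n}" and pts: "w \<circ> ?t \<circ> ?s permutes {1..n}"
      using ps pt j k by (blast intro: permutes_comp_adj_transp le_SucI)+
    obtain u where u: "grothendieck_rel n (w \<circ> ?s \<circ> ?t \<circ> ?s) u"
      using grothendieck_rel_exists permutes_comp_adj_transp pst j by metis
    have "grothendieck_rel n (w \<circ> ?s \<circ> ?t) (iso_div_diff j u)"
      by (rule grothendieck_rel.ascent) (use pst j k u in \<open>simp_all add: transpose_def\<close>)
    then have "grothendieck_rel n (w \<circ> ?s) (iso_div_diff (Suc j) (iso_div_diff j u))"
      by - (rule grothendieck_rel.ascent, use ps j k in \<open>simp_all add: transpose_def\<close>)
    then have "g = iso_div_diff (Suc j) (iso_div_diff j u)"
      using IH j by blast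
    moreover have "grothendieck_rel n (w \<circ> ?t \<circ> ?s) (iso_div_diff (Suc j) u)"
      by (rule grothendieck_rel.ascent)
         (use pts j k u[unfolded eq] in \<open>simp_all add: transpose_def\<close>)
    then have "grothendieck_rel n (w \<circ> ?t) (iso_div_diff j (iso_div_diff (Suc j) u))"
      by - (rule grothendieck_rel.ascent, use pt j k in \<open>simp_all add: transpose_def\<close>)
    then have "g' = iso_div_diff j (iso_div_diff (Suc j) u)"
      using IH[of "Suc j"] k by simp
    ultimately show ?thesis
      using iso_div_diff_braid[of j u] by simp
  qed
  have not_longest: "w \<noteq> longest_perm n" if "1 \<le> j" "j < n" "w j < w (Suc j)" for j
    using that by (auto simp: longest_perm_def)
  from less.prems(1) show ?case
  proof cases
    case longest
    from less.prems(2) show ?thesis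
    proof cases
      case longest': longest
      show ?thesis using longest longest' by simp
    next
      case (ascent k g')
      then show ?thesis using not_longest longest by blast
    qed
  next
    case j: (ascent j g)
    from less.prems(2) show ?thesis
    proof cases
      case longest
      then show ?thesis using not_longest j by blast
    next
      case k: (ascent k g')
      consider "j = k" | "Suc j < k" | "Suc k < j" | "k = Suc j" | "j = Suc k"
        by linarith
      then show ?thesis
      proof cases
        case 1
        then show ?thesis using IH j k by blast
      next
        case 2
        then show ?thesis using far j k by blast
      next
        case 3
        then show ?thesis using far j k by metis
      next
        case 4
        then show ?thesis using adjacent j k by blast
      next
        case 5
        then show ?thesis using adjacent j k by metis
      qed
    qed
  qed
qed

lemma grothendieck_rel_ex1: "w permutes {1..n} \<Longrightarrow> \<exists>!f. grothendieck_rel n w f"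
  using grothendieck_rel_exists grothendieck_rel_unique by blast

lemma grothendieck_rel_grothendieck:
  "w permutes {1..n} \<Longrightarrow> grothendieck_rel n w (grothendieck n w)"
  unfolding grothendieck_def by (rule theI'[OF grothendieck_rel_ex1])

lemma grothendieck_eqI: "grothendieck_rel n w f \<Longrightarrow> grothendieck n w = f"
  using grothendieck_rel_grothendieck grothendieck_rel_permutes grothendieck_rel_unique by blast

theorem grothendieck_longest_perm:
  "grothendieck n (longest_perm n) = (\<Prod>i\<in>{1..n}. var i ^ (n - i))"
  by (rule grothendieck_eqI) (rule grothendieck_rel.longest)

theorem grothendieck_ascent:
  assumes "w permutes {1..n}" "1 \<le> j" "j < n" "w j < w (Suc j)"
  shows "grothendieck n w = iso_div_diff j (grothendieck n (w \<circ> adj_transp j))"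
  using assms grothendieck_rel_grothendieck[OF permutes_comp_adj_transp]
  by (intro grothendieck_eqI grothendieck_rel.ascent) auto

end

theory Submission
  imports Defs
begin

text \<open>
  Column \<open>w k\<close> of the upper closure of \<open>D(w)\<close> meets row \<open>i\<close> iff \<open>w k\<close> is smaller than some
  \<open>w i'\<close> with \<open>i \<le> i' < k\<close>; hence the exponent of \<open>x\<^sub>i\<close> in the monomial of the closure is the
  number of entries of \<open>w i, \<dots>, w n\<close> that are not left-to-right maxima of that sequence.
  Bounding the degree of \<open>\<GG>\<^sub>w\<close> in each variable by this number goes by descending from the longest
  permutation, always through the \<^emph>\<open>first\<close> ascent \<open>j\<close> of \<open>w\<close>. Then \<open>w i > w j\<close> for all \<open>i < j\<close>,
  so exchanging \<open>w j\<close> and \<open>w (j + 1)\<close> does not change the number of left-to-right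
  maxima from \<open>i < j\<close> on (for an arbitrary ascent it could, whereas the operator does not lower
  the degree in \<open>x\<^sub>i\<close>), while the degrees in \<open>x\<^sub>j\<close> and \<open>x\<^bsub>j+1\<^esub>\<close> behave as needed for any ascent.
\<close>

section \<open>Degrees in a single variable\<close>

definition degree_le :: "nat \<Rightarrow> ipoly \<Rightarrow> nat \<Rightarrow> bool" where
  "degree_le i f d \<longleftrightarrow> (\<forall>m \<in> Poly_Mapping.keys f. Poly_Mapping.lookup m i \<le> d)"

lemma degree_le_mono: "degree_le i f d \<Longrightarrow> d \<le> e \<Longrightarrow> degree_le i f e"
  by (force simp: degree_le_def)

lemma degree_le_one: "degree_le i 1 d"
  by (simp add: degree_le_def)

lemma degree_le_var: "degree_le i (var k) (if i = k then 1 else 0)"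
  by (simp add: degree_le_def var_def lookup_single when_def)

lemma degree_le_diff: "degree_le i f d \<Longrightarrow> degree_le i g d \<Longrightarrow> degree_le i (f - g) d"
  using keys_diff[of f g] by (auto simp: degree_le_def)

lemma degree_le_mult:
  assumes "degree_le i f d" "degree_le i g e"
  shows "degree_le i (f * g) (d + e)"
  using assms keys_mult[of f g] by (fastforce simp: degree_le_def lookup_add intro: add_mono)

lemma degree_le_swap_vars:
  assumes "degree_le (adj_transp j i) f d"
  shows "degree_le i (swap_vars j f) d"
  unfolding degree_le_def
proof
  fix m
  assume "m \<in> Poly_Mapping.keys (swap_vars j f)"
  then have "swap_monom j m \<in> Poly_Mapping.keys f"
    by (simp add: in_keys_iff lookup_swap_vars)
  then have "Poly_Mapping.lookup (swap_monom j m) (adj_transp j i) \<le> d"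
    using assms by (simp add: degree_le_def)
  then show "Poly_Mapping.lookup m i \<le> d"
    by (simp add: lookup_swap_monom)
qed

lemma degree_le_one_minus_var: "degree_le i (1 - var k) (if i = k then 1 else 0)"
  by (intro degree_le_diff degree_le_one degree_le_var)

lemma lookup_mult_var_add:
  "Poly_Mapping.lookup (g * var a) (m + Poly_Mapping.single a 1) = Poly_Mapping.lookup g m"
  using subset_UNIV
proof (induction g rule: frag_induction)
  case (one k)
  then show ?case
    by (simp add: var_def mult_single lookup_single when_def)
qed (simp_all add: left_diff_distrib lookup_minus)

text \<open>Turns a bound on the numerator of a divided difference into one on the quotient:
  dividing by \<open>x_a - x_b\<close> gains one degree in \<open>x_a\<close> and nothing in a third
  variable.\<close>

lemma degree_le_of_mult_diff:
  assumes "a \<noteq> b" "i \<noteq> b"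
    and deg: "degree_le i (g * (var a - var b)) (d + (if i = a then 1 else 0))"
  shows "degree_le i g d"
  unfolding degree_le_def
proof
  fix m0
  assume m0: "m0 \<in> Poly_Mapping.keys g"
  \<comment> \<open>Maximality in \<open>x\<^sub>a\<close> among the monomials of large degree in \<open>x\<^sub>i\<close> rules out cancellation.\<close>
  define S where "S = {k \<in> Poly_Mapping.keys g. Poly_Mapping.lookup m0 i \<le> Poly_Mapping.lookup k i}"
  have "finite S" "S \<noteq> {}"
    using m0 by (auto simp: S_def)
  then obtain m where m: "m \<in> S"
    and max: "\<And>k. k \<in> S \<Longrightarrow> Poly_Mapping.lookup k a \<le> Poly_Mapping.lookup m a"
    using obtains_MAX[of S "\<lambda>k. Poly_Mapping.lookup k a"] by (metis Max_ge finite_imageI imageI)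
  define m' where "m' = m + Poly_Mapping.single a 1"
  have "m' \<notin> Poly_Mapping.keys (g * var b)"
  proof
    assume "m' \<in> Poly_Mapping.keys (g * var b)"
    then obtain k where k: "k \<in> Poly_Mapping.keys g" "m' = k + Poly_Mapping.single b 1"
      using keys_mult[of g "var b"] by (auto simp: var_def)
    then have eq: "Poly_Mapping.lookup (m + Poly_Mapping.single a 1) l =
        Poly_Mapping.lookup (k + Poly_Mapping.single b 1) l" for l
      by (simp add: m'_def)
    have "Poly_Mapping.lookup k a = Suc (Poly_Mapping.lookup m a)"
      using eq[of a] \<open>a \<noteq> b\<close> by (simp add: lookup_add lookup_single when_def)
    moreover have "Poly_Mapping.lookup m i \<le> Poly_Mapping.lookup k i"
      using eq[of i] \<open>i \<noteq> b\<close> by (simp add: lookup_add lookup_single when_def split: if_splits)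
    then have "k \<in> S"
      using m k by (simp add: S_def)
    ultimately show False
      using max[of k] by simp
  qed
  moreover have "Poly_Mapping.lookup (g * var a) m' \<noteq> 0"
    using m by (simp only: m'_def lookup_mult_var_add) (simp add: S_def in_keys_iff)
  ultimately have "m' \<in> Poly_Mapping.keys (g * (var a - var b))"
    by (simp add: in_keys_iff right_diff_distrib lookup_minus)
  then have "Poly_Mapping.lookup m' i \<le> d + (if i = a then 1 else 0)"
    using deg by (simp add: degree_le_def)
  then have "Poly_Mapping.lookup m i \<le> d"
    by (simp add: m'_def lookup_add lookup_single when_def split: if_splits)
  then show "Poly_Mapping.lookup m0 i \<le> d"
    using m by (simp add: S_def)
qed

lemma degree_le_iso_div_diff_other:
  assumes "i \<noteq> j" "i \<noteq> Suc j" "degree_le i f d"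
  shows "degree_le i (iso_div_diff j f) d"
proof (rule degree_le_of_mult_diff[of j "Suc j"])
  have "degree_le i ((1 - var (Suc j)) * f) (0 + d)"
    using assms degree_le_one_minus_var[of i "Suc j"] by (intro degree_le_mult) auto
  moreover have "degree_le i ((1 - var j) * swap_vars j f) (0 + d)"
    using assms degree_le_one_minus_var[of i j]
    by (intro degree_le_mult degree_le_swap_vars) (auto simp: transpose_def)
  ultimately show "degree_le i (iso_div_diff j f * (var j - var (Suc j))) (d + (if i = j then 1 else 0))"
    using assms unfolding iso_div_diff_eq by (auto intro: degree_le_diff)
qed (use assms in auto)

text \<open>The extra degree allowed in \<open>x_j\<close> is free: in both variables each term of
  the numerator has degree at most \<open>d + 1\<close>, as \<open>1 - var (Suc j)\<close> and
  \<open>1 - var j\<close> raise the degree only where it was at most \<open>d\<close>. The division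
  then removes one.\<close>

lemma degree_le_iso_div_diff:
  assumes "degree_le j f (Suc d)" "degree_le (Suc j) f d" "i = j \<or> i = Suc j"
  shows "degree_le i (iso_div_diff j f) d"
proof -
  have "degree_le i ((1 - var (Suc j)) * f) (d + 1)"
    using assms degree_le_mult[OF degree_le_one_minus_var[of i "Suc j"], of f] by force
  moreover have "degree_le i ((1 - var j) * swap_vars j f) (d + 1)"
    using assms degree_le_mult[OF degree_le_one_minus_var[of i j] degree_le_swap_vars, of j f]
    by (force simp: transpose_def)
  ultimately have "degree_le i (iso_div_diff j f * (var j - var (Suc j))) (d + 1)"
    unfolding iso_div_diff_eq by (rule degree_le_diff)
  \<comment> \<open>The sign change covers \<open>i = Suc j\<close>, since the quotient bound
    excludes the subtracted variable.\<close>
  moreover from this have "degree_le i (iso_div_diff j f * (var (Suc j) - var j)) (d + 1)"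
    by (metis degree_le_def keys_minus minus_diff_eq mult_minus_right)
  ultimately show ?thesis
    using assms(3) degree_le_of_mult_diff[of j "Suc j" i] degree_le_of_mult_diff[of "Suc j" j i]
    by auto
qed

section \<open>Entries that are not left-to-right maxima\<close>

text \<open>Positions are collected rather than values, so that exchanging two entries of
  \<open>w\<close> acts on the set through \<open>adj_transp j\<close>.\<close>

definition nonmaxima :: "nat \<Rightarrow> (nat \<Rightarrow> nat) \<Rightarrow> nat \<Rightarrow> nat set" where
  "nonmaxima n w i = {k \<in> {1..n}. \<exists>i'. i \<le> i' \<and> i' < k \<and> w k < w i'}"

lemma finite_nonmaxima [simp]: "finite (nonmaxima n w i)"
  by (simp add: nonmaxima_def)

text \<open>The size \<open>n - i\<close> is the exponent of \<open>x_i\<close> in the starting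
  monomial.\<close>

lemma nonmaxima_longest_perm:
  assumes "1 \<le> i"
  shows "nonmaxima n (longest_perm n) i = {i<..n}"
  using assms by (force simp: nonmaxima_def longest_perm_def)

lemma nonmaxima_comp_later:
  assumes "Suc j < i"
  shows "nonmaxima n (w \<circ> adj_transp j) i = nonmaxima n w i"
proof -
  have "adj_transp j k = k" if "i \<le> k" for k
    using assms that by (simp add: transpose_def)
  then show ?thesis
    by (auto simp: nonmaxima_def)
qed

lemma card_nonmaxima_comp_earlier:
  assumes "1 \<le> j" "j < n" "w j < w (Suc j)" "i < j" "w j < w i"
  shows "card (nonmaxima n (w \<circ> adj_transp j) i) \<le> card (nonmaxima n w i)"
proof (rule card_inj_on_le)
  show "inj_on (adj_transp j) (nonmaxima n (w \<circ> adj_transp j) i)"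
    by (rule inj_on_subset[OF _ subset_UNIV]) simp
  show "adj_transp j ` nonmaxima n (w \<circ> adj_transp j) i \<subseteq> nonmaxima n w i"
  proof
    fix l
    assume "l \<in> adj_transp j ` nonmaxima n (w \<circ> adj_transp j) i"
    then obtain k i' where k: "l = adj_transp j k" "k \<in> {1..n}" "i \<le> i'" "i' < k"
      "w l < w (adj_transp j i')"
      by (auto simp: nonmaxima_def)
    have l: "l \<in> {1..n}"
      using k assms by (auto simp: transpose_def)
    show "l \<in> nonmaxima n w i"
    \<comment> \<open>A witness before \<open>k\<close> stays before \<open>l\<close> under the
      exchange, except possibly when \<open>l = j\<close>, where \<open>i\<close> itself is a
      witness because \<open>w j < w i\<close>.\<close>
    proof (cases "l = j")
      case True
      then show ?thesis
        using assms l by (auto simp: nonmaxima_def)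
    next
      case False
      then have "i \<le> adj_transp j i' \<and> adj_transp j i' < l"
        using k assms by (auto simp: transpose_def split: if_splits)
      then show ?thesis
        using k l by (auto simp: nonmaxima_def)
    qed
  qed
qed simp

text \<open>Positions beyond \<open>Suc j\<close> see the same preceding entries before and after
  the exchange, so only \<open>Suc j\<close> can be new.\<close>

lemma card_nonmaxima_comp_same:
  "card (nonmaxima n (w \<circ> adj_transp j) j) \<le> Suc (card (nonmaxima n w j))"
proof -
  have "nonmaxima n (w \<circ> adj_transp j) j \<subseteq> insert (Suc j) (nonmaxima n w j)"
  proof
    fix k
    assume "k \<in> nonmaxima n (w \<circ> adj_transp j) j"
    then obtain i' where k: "k \<in> {1..n}" "j \<le> i'" "i' < k" "w (adj_transp j k) < w (adj_transp j i')"
      by (auto simp: nonmaxima_def)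
    show "k \<in> insert (Suc j) (nonmaxima n w j)"
    proof (cases "k = Suc j")
      case False
      then have "adj_transp j k = k" "j \<le> adj_transp j i'" "adj_transp j i' < k"
        using k by (auto simp: transpose_def)
      then show ?thesis
        using k by (auto simp: nonmaxima_def)
    qed simp
  qed
  then have "card (nonmaxima n (w \<circ> adj_transp j) j) \<le> card (insert (Suc j) (nonmaxima n w j))"
    by (intro card_mono) auto
  also have "\<dots> \<le> Suc (card (nonmaxima n w j))"
    by (rule card_insert_le_m1) auto
  finally show ?thesis .
qed

lemma card_nonmaxima_comp_Suc:
  "card (nonmaxima n (w \<circ> adj_transp j) (Suc j)) \<le> card (nonmaxima n w j)"
proof (intro card_mono subsetI)
  fix k
  assume "k \<in> nonmaxima n (w \<circ> adj_transp j) (Suc j)"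
  then obtain i' where k: "k \<in> {1..n}" "Suc j \<le> i'" "i' < k" "w (adj_transp j k) < w (adj_transp j i')"
    by (auto simp: nonmaxima_def)
  then have "adj_transp j k = k" "j \<le> adj_transp j i'" "adj_transp j i' < k"
    by (auto simp: transpose_def)
  then show "k \<in> nonmaxima n w j"
    using k by (auto simp: nonmaxima_def)
qed simp

text \<open>At an ascent the witness \<open>j\<close> can be replaced by the larger entry at
  \<open>Suc j\<close>.\<close>

lemma card_nonmaxima_ascent:
  assumes "w j < w (Suc j)"
  shows "card (nonmaxima n w j) \<le> card (nonmaxima n w (Suc j))"
proof (intro card_mono subsetI)
  fix k
  assume "k \<in> nonmaxima n w j"
  then obtain i' where k: "k \<in> {1..n}" "j \<le> i'" "i' < k" "w k < w i'"
    by (auto simp: nonmaxima_def)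
  then have "\<exists>i'. Suc j \<le> i' \<and> i' < k \<and> w k < w i'"
    using assms by (cases "i' = j"; cases "k = Suc j") (auto intro: exI[of _ "Suc j"] exI[of _ i'])
  then show "k \<in> nonmaxima n w (Suc j)"
    using k by (simp add: nonmaxima_def)
qed simp

lemma ex_first_ascent:
  assumes "w permutes {1..n}" "w \<noteq> longest_perm n"
  obtains j where "1 \<le> j" "j < n" "w j < w (Suc j)" "\<And>i. 1 \<le> i \<Longrightarrow> i < j \<Longrightarrow> w j < w i"
proof -
  define P where "P j \<longleftrightarrow> 1 \<le> j \<and> j < n \<and> w j < w (Suc j)" for j
  define j where "j = (LEAST j. P j)"
  have P: "P j"
    unfolding j_def by (rule LeastI_ex) (use ex_ascent[OF assms] in \<open>simp add: P_def\<close>)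
  have step: "w (Suc k) < w k" if "1 \<le> k" "k < j" for k
  proof -
    have "\<not> P k"
      using that(2) unfolding j_def by (rule not_less_Least)
    moreover have "w k \<noteq> w (Suc k)"
      using permutes_inj[OF assms(1)] by (simp add: inj_eq)
    ultimately show ?thesis
      using P that by (auto simp: P_def)
  qed
  have "w j < w i" if "1 \<le> i" "i < j" for i
    using that(2,1) by (induction rule: strict_inc_induct) (use step in \<open>auto intro: less_trans\<close>)
  then show ?thesis
    using P that unfolding P_def by blast
qed

section \<open>The degree bound\<close>

lemma prod_single: "(\<Prod>x\<in>A. Poly_Mapping.single (f x) (1::int)) = Poly_Mapping.single (\<Sum>x\<in>A. f x) 1"
  by (induction A rule: infinite_finite_induct) (simp_all add: mult_single)

text \<open>Index 0 is separate because the closure has no row 0, while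
  \<open>nonmaxima n w 0\<close> can be nonempty.\<close>

lemma degree_le_grothendieck:
  assumes "w permutes {1..n}"
  shows "degree_le i (grothendieck n w) (if i = 0 then 0 else card (nonmaxima n w i))"
  using assms
proof (induction "card (coinv n w)" arbitrary: w i rule: less_induct)
  case less
  show ?case
  proof (cases "w = longest_perm n")
    case True
    have "grothendieck n w = Poly_Mapping.single (\<Sum>k\<in>{1..n}. Poly_Mapping.single k (n - k)) 1"
      by (simp add: True grothendieck_longest_perm var_power prod_single)
    then show ?thesis
      using True by (auto simp: degree_le_def lookup_sum lookup_single when_def nonmaxima_longest_perm)
  next
    case False
    with less.prems obtain j where j: "1 \<le> j" "j < n" "w j < w (Suc j)"
      and first: "\<And>i. 1 \<le> i \<Longrightarrow> i < j \<Longrightarrow> w j < w i"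
      using ex_first_ascent by blast
    let ?u = "w \<circ> adj_transp j"
    have IH: "degree_le i (grothendieck n ?u) (if i = 0 then 0 else card (nonmaxima n ?u i))" for i
      using less.hyps coinv_less permutes_comp_adj_transp less.prems j by blast
    have G: "grothendieck n w = iso_div_diff j (grothendieck n ?u)"
      using grothendieck_ascent less.prems j by blast
    consider "i = 0" | "1 \<le> i" "i < j" | "i = j \<or> i = Suc j" | "Suc j < i"
      by linarith
    then show ?thesis
    proof cases
      case 1
      then show ?thesis
        using j IH[of 0] unfolding G by (auto intro!: degree_le_iso_div_diff_other)
    next
      case 2
      then have "degree_le i (grothendieck n ?u) (card (nonmaxima n w i))"
        using IH[of i] card_nonmaxima_comp_earlier[OF j 2(2) first]
        by (auto intro: degree_le_mono)
      then show ?thesis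
        using 2 unfolding G by (auto intro!: degree_le_iso_div_diff_other)
    next
      case 3
      \<comment> \<open>Here \<open>d\<close> is \<open>card (nonmaxima n w j)\<close>, which bounds
        the degree of the result in both variables; for \<open>i = Suc j\<close> the ascent then
        enlarges it to the stated bound.\<close>
      have "degree_le j (grothendieck n ?u) (Suc (card (nonmaxima n w j)))"
        using IH[of j] j card_nonmaxima_comp_same[of n w j] by (auto intro: degree_le_mono)
      moreover have "degree_le (Suc j) (grothendieck n ?u) (card (nonmaxima n w j))"
        using IH[of "Suc j"] card_nonmaxima_comp_Suc[of n w j] by (auto intro: degree_le_mono)
      ultimately have "degree_le i (grothendieck n w) (card (nonmaxima n w j))"
        using 3 unfolding G by (rule degree_le_iso_div_diff)
      then show ?thesis
        using 3 j card_nonmaxima_ascent[of w j n] by (auto intro: degree_le_mono)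
    next
      case 4
      then show ?thesis
        using IH[of i] nonmaxima_comp_later[OF 4, of n w] unfolding G
        by (auto intro!: degree_le_iso_div_diff_other)
    qed
  qed
qed

section \<open>Rows of the closure and divisibility of monomials\<close>

lemma finite_upper_closure_rothe_diagram: "finite (upper_closure (rothe_diagram n w))"
  by (rule finite_subset[of _ "{1..n} \<times> {1..n}"]) (auto simp: upper_closure_def rothe_diagram_def)

lemma diagram_monomial_eq:
  "diagram_monomial D = Poly_Mapping.single (\<Sum>(i, j)\<in>D. Poly_Mapping.single i 1) 1"
  using prod_single[of "\<lambda>(i, j). Poly_Mapping.single i (1::nat)" D]
  by (simp add: diagram_monomial_def var_def case_prod_unfold)

lemma lookup_row_sum:
  assumes "finite D"
  shows "Poly_Mapping.lookup (\<Sum>(k, j)\<in>D. Poly_Mapping.single k (1::nat)) i = card {j. (i, j) \<in> D}"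
proof -
  have "Poly_Mapping.lookup (\<Sum>(k, j)\<in>D. Poly_Mapping.single k (1::nat)) i = card {x \<in> D. fst x = i}"
    using assms
    by (simp add: lookup_sum lookup_single case_prod_unfold when_def sum.If_cases Int_def)
  also have "{x \<in> D. fst x = i} = Pair i ` {j. (i, j) \<in> D}"
    by auto
  also have "card \<dots> = card {j. (i, j) \<in> D}"
    by (rule card_image) (simp add: inj_on_def)
  finally show ?thesis .
qed

lemma row_upper_closure_rothe_diagram:
  assumes w: "w permutes {1..n}" and "1 \<le> i"
  shows "{c. (i, c) \<in> upper_closure (rothe_diagram n w)} = w ` nonmaxima n w i"
proof (intro equalityI subsetI)
  fix c
  assume "c \<in> {c. (i, c) \<in> upper_closure (rothe_diagram n w)}"
  then obtain i' where c: "c \<in> {1..n}" "i \<le> i'" "i' < inv w c" "c < w i'"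
    by (auto simp: upper_closure_def rothe_diagram_def)
  moreover have "w (inv w c) = c"
    using permutes_inverses(1)[OF w] .
  moreover have "inv w c \<in> {1..n}"
    using c(1) permutes_in_image[OF permutes_inv[OF w]] by blast
  ultimately have "inv w c \<in> nonmaxima n w i"
    by (auto simp: nonmaxima_def)
  with \<open>w (inv w c) = c\<close> show "c \<in> w ` nonmaxima n w i"
    by (metis imageI)
next
  fix c
  assume "c \<in> w ` nonmaxima n w i"
  then obtain k i' where k: "c = w k" "k \<in> {1..n}" "i \<le> i'" "i' < k" "w k < w i'"
    by (auto simp: nonmaxima_def)
  have "(i', w k) \<in> rothe_diagram n w"
    using k \<open>1 \<le> i\<close> permutes_in_image[OF w, of k] permutes_inverses(2)[OF w]
    by (auto simp: rothe_diagram_def)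
  then show "c \<in> {c. (i, c) \<in> upper_closure (rothe_diagram n w)}"
    using k \<open>1 \<le> i\<close> by (auto simp: upper_closure_def)
qed

lemma single_dvd_single:
  fixes m m' :: monom
  assumes "\<And>i. Poly_Mapping.lookup m i \<le> Poly_Mapping.lookup m' i"
  shows "Poly_Mapping.single m (1::int) dvd Poly_Mapping.single m' 1"
proof
  \<comment> \<open>Subtraction of exponents is truncated, but the hypothesis makes it exact, so
    \<open>m' - m\<close> is the exponent of the cofactor.\<close>
  have "m' = m + (m' - m)"
    using assms by (intro poly_mapping_eqI) (simp add: lookup_add lookup_minus)
  then show "Poly_Mapping.single m' (1::int) = Poly_Mapping.single m 1 * Poly_Mapping.single (m' - m) 1"
    by (simp add: mult_single)
qed

theorem theorem1p2:
  fixes n :: nat and w :: "nat \<Rightarrow> nat"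
  assumes "w permutes {1..n}"
  shows "\<forall>m \<in> Poly_Mapping.keys (grothendieck n w).
           Poly_Mapping.single m 1 dvd diagram_monomial (upper_closure (rothe_diagram n w))"
proof
  fix m
  assume m: "m \<in> Poly_Mapping.keys (grothendieck n w)"
  let ?D = "upper_closure (rothe_diagram n w)"
  have "Poly_Mapping.lookup m i \<le> card {c. (i, c) \<in> ?D}" for i
  proof (cases "i = 0")
    case False
    have "inj_on w (nonmaxima n w i)"
      using permutes_inj[OF assms] by (rule inj_on_subset) simp
    then show ?thesis
      using m False degree_le_grothendieck[OF assms, of i]
      by (simp add: degree_le_def row_upper_closure_rothe_diagram[OF assms] card_image)
  qed (use m degree_le_grothendieck[OF assms, of 0] in \<open>simp add: degree_le_def\<close>)
  then show "Poly_Mapping.single m 1 dvd diagram_monomial ?D"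
    unfolding diagram_monomial_eq
    by (intro single_dvd_single) (simp only: lookup_row_sum finite_upper_closure_rothe_diagram)
qed

end
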